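(* Let $G=(V,E)$ be a finite simple graph with $n$ vertices, adjacency matrix $A$ and eigenvalues $\lambda_1\ge\lambda_2\ge\cdots\ge\lambda_n$ (listed with multiplicity). Let $k\ge 1$ be an integer and let $p\in\mathbb{R}_k[x]$. Put $W(p)=\max_{u\in V}(p(A))_{uu}$ and $w(p)=\min_{u\in V}(p(A))_{uu}$. Then the $k$-independence number of $G$ satisfies $$\alpha_k(G)\le \min\bigl\{\,|\{i : p(\lambda_i)\ge w(p)\}|,\ |\{i : p(\lambda_i)\le W(p)\}|\,\bigr\}.$$
   Context: $\mathbb{R}_k[x]$ denotes the set of real polynomials of degree at most $k$. The $k$-independence number $\alpha_k(G)$ is the maximum size of a set of vertices of $G$ such that any two distinct vertices of the set are at distance greater than $k$ in $G$ (vertices in different components are at infinite distance). The eigenvalues of a graph are those of its adjacency matrix. *)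

theory Defs
  imports
    "Graph_Theory.Graph_Theory"
    "Jordan_Normal_Form.Char_Poly"
begin

text \<open>
  A finite simple graph is the locale \<^locale>\<open>graph\<close> of the Graph Theory library: a finite
  digraph without loops and parallel arcs whose adjacency relation is symmetric.
\<close>

text \<open>
  With unit arc weights the cost of a walk is its length; the infimum over the empty set of walks
  is \<open>\<infinity>\<close>, so vertices in different components are at infinite distance.
\<close>
definition graph_dist :: "('v, 'e) pre_digraph \<Rightarrow> 'v \<Rightarrow> 'v \<Rightarrow> ereal" where
  "graph_dist G u v = wf_digraph.\<mu> G (\<lambda>_. 1) u v"

definition k_independent :: "('v, 'e) pre_digraph \<Rightarrow> nat \<Rightarrow> 'v set \<Rightarrow> bool" where
  "k_independent G k S \<longleftrightarrow>
     S \<subseteq> verts G \<and> (\<forall>u\<in>S. \<forall>v\<in>S. u \<noteq> v \<longrightarrow> graph_dist G u v > ereal (real k))"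

definition k_independence_number :: "('v, 'e) pre_digraph \<Rightarrow> nat \<Rightarrow> nat" where
  "k_independence_number G k = Max (card ` {S. k_independent G k S})"

text \<open>
  Matrices are indexed by \<open>{0..<n}\<close>, so the adjacency matrix is taken with respect to an
  enumeration \<open>vs\<close> of the vertices: row and column \<open>i\<close> belong to the vertex \<open>vs ! i\<close>.
\<close>
definition adjacency_matrix :: "('v, 'e) pre_digraph \<Rightarrow> 'v list \<Rightarrow> real mat" where
  "adjacency_matrix G vs =
     mat (length vs) (length vs) (\<lambda>(i, j). if (vs ! i, vs ! j) \<in> arcs_ends G then 1 else 0)"

text \<open>
  The real roots of the characteristic polynomial with their multiplicities, in nonincreasing order
  (position \<open>i\<close> holds \<open>\<lambda>\<^sub>i\<^sub>+\<^sub>1\<close>). For an adjacency matrix of a graph the list has length \<open>n\<close>;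
  see \<open>length_eigenvalues_adjacency_matrix\<close>.
\<close>
definition eigenvalues :: "real mat \<Rightarrow> real list" where
  "eigenvalues A = rev (sorted_list_of_multiset (proots (char_poly A)))"

lemma proots_prod_list_linear: "proots (\<Prod>a\<leftarrow>as. [:- a, 1:]) = mset (as :: 'a :: idom list)"
proof (induction as)
  case (Cons a as)
  have "(\<Prod>a\<leftarrow>as. [:- a, 1:]) \<noteq> 0" by (auto simp: prod_list_zero_iff)
  then show ?case by (simp add: proots_mult Cons del: mult_pCons_left)
qed simp

lemma length_eigenvalues_symmetric:
  fixes A :: "real mat"
  assumes A: "A \<in> carrier_mat n n" and sym: "transpose_mat A = A"
  shows "length (eigenvalues A) = n"
proof -
  interpret of_real_poly_hom: map_poly_inj_idom_hom "of_real :: real \<Rightarrow> complex" ..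
  let ?B = "map_mat complex_of_real A"
  have B: "?B \<in> carrier_mat n n" and symB: "transpose_mat ?B = ?B"
    using A sym by (auto simp: map_mat_transpose)
  have hom: "char_poly ?B = map_poly of_real (char_poly A)"
    by (rule of_real_hom.char_poly_hom[OF A])
  obtain as where as: "char_poly ?B = (\<Prod>a\<leftarrow>as. [:- a, 1:])" and len: "length as = n"
    using char_poly_factorized[OF B] by blast
  have real_as: "of_real (Re e) = e" if "e \<in> set as" for e
  proof -
    have "poly (char_poly ?B) e = 0"
      unfolding as poly_prod_list prod_list_zero_iff using that by force
    then have "eigenvalue ?B e"
      by (simp add: eigenvalue_root_char_poly[OF B])
    then obtain v where v: "v \<in> carrier_vec n" "v \<noteq> 0\<^sub>v n" and ev: "?B *\<^sub>v v = e \<cdot>\<^sub>v v"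
      unfolding eigenvalue_def eigenvector_def using B by auto
    let ?c = "conjugate v"
    have c: "?c \<in> carrier_vec n" using v by simp
    have "?B *\<^sub>v ?c = conjugate (?B *\<^sub>v v)"
      using A v by (intro eq_vecI) (auto simp: scalar_prod_def)
    then have evc: "?B *\<^sub>v ?c = cnj e \<cdot>\<^sub>v ?c"
      unfolding ev by (simp add: conjugate_smult_vec)
    have "(?B *\<^sub>v v) \<bullet> ?c = v \<bullet> (?B *\<^sub>v ?c)"
      using transpose_vec_mult_scalar[OF B c v(1)] by (simp add: symB)
    then have "e * (v \<bullet> ?c) = cnj e * (v \<bullet> ?c)"
      unfolding ev evc using v c by simp
    moreover have "v \<bullet> ?c \<noteq> 0"
      using v by simp
    ultimately have "e = cnj e" by simp
    then show ?thesis by (metis Reals_cnj_iff of_real_Re)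
  qed
  have "map_poly complex_of_real (char_poly A) =
      map_poly complex_of_real (\<Prod>a\<leftarrow>map Re as. [:- a, 1:])"
  proof -
    have "map_poly complex_of_real (\<Prod>a\<leftarrow>map Re as. [:- a, 1:]) =
        (\<Prod>a\<leftarrow>as. [:- of_real (Re a), 1:])"
      by (simp add: of_real_poly_hom.hom_prod_list o_def)
    also have "\<dots> = (\<Prod>a\<leftarrow>as. [:- a, 1:])"
      using real_as by (intro arg_cong[where f = prod_list] map_cong) auto
    finally show ?thesis using as hom by simp
  qed
  then have "char_poly A = (\<Prod>a\<leftarrow>map Re as. [:- a, 1:])"
    by (rule of_real_poly_hom.injectivity)
  then have "proots (char_poly A) = mset (map Re as)"
    by (simp only: proots_prod_list_linear)
  then show ?thesis
    by (metis eigenvalues_def len length_map length_rev mset_sorted_list_of_multiset size_mset)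
qed

lemma length_eigenvalues_adjacency_matrix:
  assumes "graph G" and "distinct vs" and "set vs = verts G"
  shows "length (eigenvalues (adjacency_matrix G vs)) = card (verts G)"
proof -
  interpret graph G by fact
  have "transpose_mat (adjacency_matrix G vs) = adjacency_matrix G vs"
    using sym_arcs by (intro eq_matI) (auto simp: adjacency_matrix_def symmetric_def dest: symD)
  moreover have "adjacency_matrix G vs \<in> carrier_mat (length vs) (length vs)"
    by (simp add: adjacency_matrix_def)
  ultimately have "length (eigenvalues (adjacency_matrix G vs)) = length vs"
    by (intro length_eigenvalues_symmetric)
  then show ?thesis
    using assms distinct_card by metis
qed

definition poly_mat :: "real poly \<Rightarrow> real mat \<Rightarrow> real mat" where
  "poly_mat p A =
     mat (dim_row A) (dim_row A) (\<lambda>(r, s). \<Sum>i\<le>degree p. coeff p i * (A ^\<^sub>m i) $$ (r, s))"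

end

theory Submission
  imports Defs
begin

text \<open>
  Let \<open>U\<close> be a \<open>k\<close>-independent set. Entries of \<open>A\<^sup>i\<close> count walks of length \<open>i\<close>, so the principal
  submatrix of \<open>p(A)\<close> on \<open>U\<close> is diagonal with entries at least \<open>w\<close>, and \<open>x\<^sup>T p(A) x \<ge> w |x|\<^sup>2\<close> for all
  \<open>x\<close> supported on \<open>U\<close>. If \<open>U\<close> had more elements than there are \<open>i\<close> with \<open>p(\<lambda>\<^sub>i) \<ge> w\<close>, some nonzero
  such \<open>x\<close> would be orthogonal to all the corresponding eigenvectors, and the spectral theorem would
  give \<open>x\<^sup>T p(A) x < w |x|\<^sup>2\<close>. The other bound is the same argument for \<open>-p\<close>.
\<close>

section \<open>Householder reflections and the spectral theorem for real symmetric matrices\<close>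

text \<open>
  A Householder reflection; for \<open>w = 0\<close> the division by zero makes it the identity matrix, so the
  lemmas below need no nonzero assumption.
\<close>
definition reflection_mat :: "nat \<Rightarrow> real vec \<Rightarrow> real mat" where
  "reflection_mat n w =
     mat n n (\<lambda>(i, j). (if i = j then 1 else 0) - 2 / (w \<bullet> w) * (w $ i) * (w $ j))"

lemma reflection_mat_carrier [simp]: "reflection_mat n w \<in> carrier_mat n n"
  by (simp add: reflection_mat_def)

lemma transpose_reflection_mat [simp]: "transpose_mat (reflection_mat n w) = reflection_mat n w"
  by (intro eq_matI) (auto simp: reflection_mat_def)

lemma reflection_mat_mult_vec:
  assumes "w \<in> carrier_vec n" "x \<in> carrier_vec n"
  shows "reflection_mat n w *\<^sub>v x = x - (2 / (w \<bullet> w) * (w \<bullet> x)) \<cdot>\<^sub>v w"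
proof (intro eq_vecI)
  fix i assume "i < dim_vec (x - (2 / (w \<bullet> w) * (w \<bullet> x)) \<cdot>\<^sub>v w)"
  then have i: "i < n" using assms by simp
  have "(reflection_mat n w *\<^sub>v x) $ i =
      (\<Sum>j\<in>{0..<n}. (if i = j then x $ j else 0) - 2 / (w \<bullet> w) * (w $ i) * (w $ j * x $ j))"
    using assms i
    by (auto simp: reflection_mat_def scalar_prod_def left_diff_distrib mult.assoc intro!: sum.cong)
  also have "\<dots> = x $ i - 2 / (w \<bullet> w) * (w $ i) * (w \<bullet> x)"
    using assms i by (simp add: sum_subtractf sum_distrib_left scalar_prod_def)
  finally show "(reflection_mat n w *\<^sub>v x) $ i = (x - (2 / (w \<bullet> w) * (w \<bullet> x)) \<cdot>\<^sub>v w) $ i"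
    using assms i by simp
qed (use assms in \<open>auto simp: reflection_mat_def\<close>)

text \<open>Applying the reflection twice to \<open>x\<close> adds the multiple
  \<open>- 2 * ?c + ?c * ?c * (w \<bullet> w)\<close> of \<open>(w \<bullet> x)\<close> times
  \<open>w\<close>, and this coefficient vanishes.\<close>

lemma reflection_mat_involution:
  assumes w: "w \<in> carrier_vec n"
  shows "reflection_mat n w * reflection_mat n w = 1\<^sub>m n"
proof -
  let ?H = "reflection_mat n w" and ?c = "2 / (w \<bullet> w)"
  have "(?H * ?H) *\<^sub>v x = 1\<^sub>m n *\<^sub>v x" if x: "x \<in> carrier_vec n" for x
  proof -
    have "?H *\<^sub>v (?H *\<^sub>v x) = x"
    proof (intro eq_vecI)
      fix i assume i: "i < dim_vec x"
      \<comment> \<open>This covers \<open>w = 0\<close> as well: division by zero makes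
        \<open>?c\<close> zero, and both sides vanish.\<close>
      have c: "?c * ?c * (w \<bullet> w) = 2 * ?c" by simp
      have "(?H *\<^sub>v (?H *\<^sub>v x)) $ i
          = x $ i - 2 * ?c * (w \<bullet> x) * w $ i + (?c * ?c * (w \<bullet> w)) * (w \<bullet> x) * w $ i"
        using w x i by (simp add: reflection_mat_mult_vec scalar_prod_minus_distrib algebra_simps)
      then show "(?H *\<^sub>v (?H *\<^sub>v x)) $ i = x $ i"
        unfolding c by simp
    qed (use x in \<open>auto simp: reflection_mat_def\<close>)
    then show ?thesis
      using x by (simp add: assoc_mult_mat_vec[OF reflection_mat_carrier reflection_mat_carrier])
  qed
  \<comment> \<open>Unit vectors pick out columns, so agreement on them yields agreement of all
    entries.\<close>
  then have *: "((?H * ?H) *\<^sub>v unit_vec n j) $ i = (1\<^sub>m n *\<^sub>v unit_vec n j) $ i" for i j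
    by simp
  have "(?H * ?H) $$ (i, j) = 1\<^sub>m n $$ (i, j)" if "i < n" "j < n" for i j
  proof -
    have "((?H * ?H) *\<^sub>v unit_vec n j) $ i = row (?H * ?H) i $ j"
      using that by (subst index_mult_mat_vec) (simp_all add: reflection_mat_def scalar_prod_right_unit)
    then show ?thesis
      using that *[of j i] by (simp add: reflection_mat_def)
  qed
  then show ?thesis
    by (intro eq_matI) (auto simp: reflection_mat_def)
qed

text \<open>For unit vectors, \<open>w = u - v\<close> satisfies
  \<open>w \<bullet> w = 2 * (w \<bullet> u)\<close>, so the reflection subtracts exactly
  \<open>w\<close> from \<open>u\<close>. If \<open>u = v\<close>, the reflection is the
  identity.\<close>

lemma reflection_mat_swap:
  assumes "u \<in> carrier_vec n" "v \<in> carrier_vec n" and "u \<bullet> u = 1" "v \<bullet> v = 1"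
  shows "reflection_mat n (u - v) *\<^sub>v u = v"
proof -
  define w where "w = u - v"
  have w: "w \<in> carrier_vec n" using assms by (simp add: w_def)
  have wu: "w \<bullet> u = 1 - u \<bullet> v" and ww: "w \<bullet> w = 2 * (1 - u \<bullet> v)"
    using assms comm_scalar_prod[of v n u]
    by (simp_all add: w_def scalar_prod_minus_distrib minus_scalar_prod_distrib)
  have "2 / (w \<bullet> w) * (w \<bullet> u) = 1" if "w \<noteq> 0\<^sub>v n"
  proof -
    have "w \<bullet> w \<noteq> 0" using that w conjugate_square_eq_0_vec[of w n] by simp
    then show ?thesis using wu ww by (simp add: field_simps)
  qed
  then have "reflection_mat n w *\<^sub>v u = u - w"
    using w assms by (cases "w = 0\<^sub>v n") (auto simp: reflection_mat_mult_vec)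
  also have "\<dots> = v"
    using assms by (intro eq_vecI) (auto simp: w_def)
  finally show ?thesis by (simp add: w_def)
qed

text \<open>The characteristic polynomial has \<open>n\<close> real roots by
  \<open>length_eigenvalues_symmetric\<close>. Since \<open>n > 0\<close> there is at least one, and
  an eigenvector for it can be normalized.\<close>

lemma symmetric_mat_eigenvector_exists:
  fixes A :: "real mat"
  assumes A: "A \<in> carrier_mat n n" and sym: "transpose_mat A = A" and n: "n > 0"
  obtains v e where "v \<in> carrier_vec n" "v \<bullet> v = 1" "A *\<^sub>v v = e \<cdot>\<^sub>v v"
proof -
  have "eigenvalues A \<noteq> []"
    using length_eigenvalues_symmetric[OF A sym] n by auto
  then have "proots (char_poly A) \<noteq> {#}"
    by (auto simp: eigenvalues_def)
  then obtain e where "e \<in># proots (char_poly A)" by blast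
  moreover have "char_poly A \<noteq> 0"
    using degree_monic_char_poly[OF A] by auto
  ultimately have "eigenvalue A e"
    by (simp add: eigenvalue_root_char_poly[OF A])
  then obtain x where x: "x \<in> carrier_vec n" "x \<noteq> 0\<^sub>v n" and ev: "A *\<^sub>v x = e \<cdot>\<^sub>v x"
    unfolding eigenvalue_def eigenvector_def using A by auto
  have "x \<bullet> x > 0"
    using x conjugate_square_greater_0_vec[of x n] by simp
  then show ?thesis
    using x ev A
    by (intro that[of "(1 / sqrt (x \<bullet> x)) \<cdot>\<^sub>v x" e])
       (auto simp: mult_mat_vec smult_smult_assoc mult.commute)
qed

text \<open>
  Conjugating with the reflection that swaps the first unit vector and a unit eigenvector splits
  off a \<open>1 \<times> 1\<close> block.
\<close>
theorem symmetric_mat_diagonalizable: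
  fixes A :: "real mat"
  assumes "A \<in> carrier_mat n n" and "transpose_mat A = A"
  shows "\<exists>D P. similar_mat_wit A D P (transpose_mat P) \<and> diagonal_mat D"
  using assms
proof (induction n arbitrary: A)
  case 0
  then have "similar_mat_wit A A (1\<^sub>m 0) (transpose_mat (1\<^sub>m 0))" "diagonal_mat A"
    using similar_mat_wit_refl[of A 0] by (auto simp: diagonal_mat_def)
  then show ?case by blast
next
  case (Suc n)
  note A = Suc.prems(1) and sym = Suc.prems(2)
  obtain v e where v: "v \<in> carrier_vec (Suc n)" "v \<bullet> v = 1" and ev: "A *\<^sub>v v = e \<cdot>\<^sub>v v"
    using symmetric_mat_eigenvector_exists[OF A sym] by blast
  let ?e0 = "unit_vec (Suc n) 0 :: real vec"
  define H where "H = reflection_mat (Suc n) (?e0 - v)"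
  have H [simp]: "H \<in> carrier_mat (Suc n) (Suc n)" and HT [simp]: "transpose_mat H = H"
    by (simp_all add: H_def)
  have HH: "H * H = 1\<^sub>m (Suc n)"
    using v by (simp add: H_def reflection_mat_involution)
  have He0: "H *\<^sub>v ?e0 = v"
    using v unfolding H_def by (intro reflection_mat_swap) auto
  have Hv: "H *\<^sub>v v = ?e0"
    using HH He0 assoc_mult_mat_vec[OF H H, of ?e0] by simp
  define B where "B = H * A * H"
  have B: "B \<in> carrier_mat (Suc n) (Suc n)"
    using A unfolding B_def by (meson H mult_carrier_mat)
  have simAB: "similar_mat_wit A B H H"
  proof (intro similar_mat_witI)
    have "H * B * H = (H * H) * A * (H * H)"
      using A H by (simp add: B_def mult_carrier_mat[of _ "Suc n" "Suc n" _ "Suc n"]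
          assoc_mult_mat[of _ "Suc n" "Suc n" _ "Suc n" _ "Suc n"])
    then show "A = H * B * H" using A by (simp add: HH)
  qed (use A B HH in auto)
  have symB: "transpose_mat B = B"
    using A H sym
    by (simp add: B_def transpose_mult[of _ "Suc n" "Suc n" _ "Suc n"]
        mult_carrier_mat[of _ "Suc n" "Suc n" _ "Suc n"]
        assoc_mult_mat[of _ "Suc n" "Suc n" _ "Suc n" _ "Suc n"])
  \<comment> \<open>\<open>H\<close> sends \<open>?e0\<close> to \<open>v\<close>, \<open>A\<close>
    scales \<open>v\<close> by \<open>e\<close>, and \<open>H\<close> sends \<open>v\<close> back to
    \<open>?e0\<close>. By symmetry the first row of \<open>B\<close> has the same shape as its
    first column, so only \<open>e\<close> and the block \<open>A'\<close> remain.\<close>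
  have "col B 0 = B *\<^sub>v ?e0"
    using B by (intro eq_vecI) (auto simp: scalar_prod_right_unit)
  also have "\<dots> = e \<cdot>\<^sub>v ?e0"
    using A v by (simp add: B_def assoc_mult_mat_vec[of _ "Suc n" "Suc n" _ "Suc n"] He0 ev
        mult_carrier_mat[of _ "Suc n" "Suc n" _ "Suc n"]
        mult_mat_vec[OF H] Hv)
  finally have col0: "col B 0 = e \<cdot>\<^sub>v ?e0" .
  have Bi0: "B $$ (i, 0) = (if i = 0 then e else 0)" if "i < Suc n" for i
    using arg_cong[OF col0, of "\<lambda>x. x $ i"] B that by simp
  have B_sym: "B $$ (i, j) = B $$ (j, i)" if "i < Suc n" "j < Suc n" for i j
    using arg_cong[OF symB, of "\<lambda>x. x $$ (j, i)"] B that by simp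
  define A' where "A' = mat n n (\<lambda>(i, j). B $$ (Suc i, Suc j))"
  have A': "A' \<in> carrier_mat n n" by (simp add: A'_def)
  have symA': "transpose_mat A' = A'"
    using B_sym by (intro eq_matI) (auto simp: A'_def)
  obtain D P where sim': "similar_mat_wit A' D P (transpose_mat P)" and D: "diagonal_mat D"
    using Suc.IH[OF A' symA'] by blast
  have P: "P \<in> carrier_mat n n" and Dc: "D \<in> carrier_mat n n"
    using similar_mat_witD2[OF A' sim'] by auto
  let ?E = "mat 1 1 (\<lambda>_. e)"
  let ?Q = "four_block_mat (1\<^sub>m 1) (0\<^sub>m 1 n) (0\<^sub>m n 1) P"
  let ?D = "four_block_mat ?E (0\<^sub>m 1 n) (0\<^sub>m n 1) D"
  have B_eq: "B = four_block_mat ?E (0\<^sub>m 1 n) (0\<^sub>m n 1) A'"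
    using B Bi0 B_sym[of 0] by (intro eq_matI) (auto simp: A'_def)
  have QT: "transpose_mat ?Q = four_block_mat (1\<^sub>m 1) (0\<^sub>m 1 n) (0\<^sub>m n 1) (transpose_mat P)"
    using P by (simp add: transpose_four_block_mat[of _ 1 1 _ n _ n])
  have "similar_mat_wit B ?D ?Q (transpose_mat ?Q)"
    unfolding QT B_eq
    using P by (intro similar_mat_wit_four_block[OF similar_mat_wit_refl sim']) (auto simp: A')
  \<comment> \<open>As \<open>H\<close> is its own transpose, the two inverse factors multiply to
    the transpose of \<open>H * ?Q\<close>.\<close>
  from similar_mat_wit_trans[OF simAB this]
  have "similar_mat_wit A ?D (H * ?Q) (transpose_mat (H * ?Q))"
    using transpose_mult[of H "Suc n" "Suc n" ?Q "Suc n"] P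
      four_block_carrier_mat[of "1\<^sub>m 1" 1 1 P n n] by simp
  moreover have "diagonal_mat ?D"
    using D Dc by (auto simp: diagonal_mat_def)
  ultimately show ?case by blast
qed

section \<open>Matrix polynomials and eigenvalue counts under orthogonal diagonalization\<close>

lemma diagonal_mat_pow_index:
  assumes D: "D \<in> carrier_mat n n" and diag: "diagonal_mat D" and "i < n" "j < n"
  shows "(D ^\<^sub>m k) $$ (i, j) = (if i = j then D $$ (i, i) ^ k else 0)"
  using assms(3,4)
proof (induction k arbitrary: j)
  case (Suc k)
  have "(D ^\<^sub>m Suc k) $$ (i, j) = (\<Sum>l\<in>{0..<n}. (D ^\<^sub>m k) $$ (i, l) * D $$ (l, j))"
    using D Suc.prems by (simp add: scalar_prod_def)
  also have "\<dots> = (\<Sum>l\<in>{0..<n}. if i = l then D $$ (i, i) ^ k * D $$ (i, j) else 0)"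
    using Suc by (intro sum.cong) auto
  also have "\<dots> = D $$ (i, i) ^ k * D $$ (i, j)" using Suc.prems by simp
  also have "\<dots> = (if i = j then D $$ (i, i) ^ Suc k else 0)"
    using D diag Suc.prems by (auto simp: diagonal_mat_def power_Suc2 simp del: power_Suc)
  finally show ?case .
qed (use D in auto)

text \<open>Each power of \<open>A\<close> is \<open>P\<close> times the same power of
  \<open>D\<close> times the transpose of \<open>P\<close>. Weighting by the coefficients of
  \<open>p\<close> and swapping the two sums collects \<open>poly p\<close> at each diagonal
  entry.\<close>

lemma poly_mat_orthogonal_diagonalization:
  assumes A: "A \<in> carrier_mat n n" and sim: "similar_mat_wit A D P (transpose_mat P)"
    and diag: "diagonal_mat D" and r: "r < n" and s: "s < n"
  shows "poly_mat p A $$ (r, s) = (\<Sum>j<n. P $$ (r, j) * poly p (D $$ (j, j)) * P $$ (s, j))"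
proof -
  have P: "P \<in> carrier_mat n n" and D: "D \<in> carrier_mat n n"
    using similar_mat_witD2[OF A sim] by auto
  have pow: "(A ^\<^sub>m i) $$ (r, s) = (\<Sum>j<n. P $$ (r, j) * D $$ (j, j) ^ i * P $$ (s, j))" for i
  proof -
    have PD: "(P * D ^\<^sub>m i) $$ (r, j) = P $$ (r, j) * D $$ (j, j) ^ i" if j: "j < n" for j
    proof -
      have "(P * D ^\<^sub>m i) $$ (r, j) = (\<Sum>l\<in>{0..<n}. P $$ (r, l) * (D ^\<^sub>m i) $$ (l, j))"
        using P D r j by (simp add: scalar_prod_def)
      also have "\<dots> = (\<Sum>l\<in>{0..<n}. if j = l then P $$ (r, j) * D $$ (j, j) ^ i else 0)"
        using j by (intro sum.cong) (auto simp: diagonal_mat_pow_index[OF D diag])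
      finally show ?thesis using j by simp
    qed
    have "(A ^\<^sub>m i) $$ (r, s) = (P * D ^\<^sub>m i * transpose_mat P) $$ (r, s)"
      by (simp only: similar_mat_wit_pow_id[OF sim])
    also have "\<dots> = (\<Sum>j\<in>{0..<n}. (P * D ^\<^sub>m i) $$ (r, j) * P $$ (s, j))"
      using P D r s by (simp add: scalar_prod_def)
    finally show ?thesis
      by (simp add: PD atLeast0LessThan)
  qed
  have "poly_mat p A $$ (r, s) =
      (\<Sum>i\<le>degree p. \<Sum>j<n. coeff p i * (P $$ (r, j) * D $$ (j, j) ^ i * P $$ (s, j)))"
    using A r s by (simp add: poly_mat_def pow sum_distrib_left)
  also have "\<dots> = (\<Sum>j<n. P $$ (r, j) * poly p (D $$ (j, j)) * P $$ (s, j))"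
    by (subst sum.swap)
       (auto simp: poly_altdef sum_distrib_left sum_distrib_right mult_ac intro!: sum.cong)
  finally show ?thesis .
qed

text \<open>Similar matrices share their characteristic polynomial, and that of a diagonal matrix
  splits into linear factors given by its diagonal.\<close>

lemma mset_eigenvalues_similar_diagonal:
  assumes A: "A \<in> carrier_mat n n" and sim: "similar_mat_wit A D P Q" and diag: "diagonal_mat D"
  shows "mset (eigenvalues A) = mset (map (\<lambda>j. D $$ (j, j)) [0..<n])"
proof -
  have D: "D \<in> carrier_mat n n" using similar_mat_witD2[OF A sim] by auto
  have "char_poly A = char_poly D"
    using sim by (intro char_poly_similar) (auto simp: similar_mat_def)
  also have "\<dots> = (\<Prod>a\<leftarrow>diag_mat D. [:- a, 1:])"
    using D diag by (intro char_poly_upper_triangular) (auto simp: diagonal_mat_def)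
  finally have "proots (char_poly A) = mset (diag_mat D)"
    by (simp only: proots_prod_list_linear)
  then show ?thesis
    using D by (simp add: eigenvalues_def diag_mat_def)
qed

text \<open>Counts of indices depend only on the multiset of values. This moves counts from the
  sorted eigenvalue list to the diagonal of \<open>D\<close>, whose order is arbitrary.\<close>

lemma card_nth_filter_eq:
  assumes "mset xs = mset (map f [0..<n])"
  shows "card {i. i < n \<and> Q (xs ! i)} = card {j. j < n \<and> Q (f j)}"
proof -
  have "length xs = n" using arg_cong[OF assms, of size] by simp
  then have "card {i. i < n \<and> Q (xs ! i)} = length (filter Q xs)"
    by (simp add: length_filter_conv_card)
  also have "\<dots> = size (filter_mset Q (mset xs))"
    by (simp flip: mset_filter)
  also have "\<dots> = length (filter Q (map f [0..<n]))"
    unfolding assms by (simp only: size_mset flip: mset_filter)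
  also have "\<dots> = card {j. j < n \<and> Q (f j)}"
    by (simp add: length_filter_conv_card cong: conj_cong)
  finally show ?thesis .
qed

section \<open>The inertia argument in coordinates\<close>

text \<open>With fewer equations than unknowns, padding by zero rows gives a square singular matrix,
  whose kernel supplies the solution.\<close>

lemma homogeneous_system_nontrivial_solution:
  fixes a :: "'i \<Rightarrow> 'u \<Rightarrow> real"
  assumes I: "finite I" and U: "finite U" and less: "card I < card U"
  obtains x where "\<exists>u\<in>U. x u \<noteq> 0" and "\<And>i. i \<in> I \<Longrightarrow> (\<Sum>u\<in>U. a i u * x u) = 0"
proof -
  define m where "m = card U"
  obtain f where f: "bij_betw f {..<m} U"
    using ex_bij_betw_nat_finite[OF U] by (auto simp: m_def atLeast0LessThan)
  obtain g where g: "bij_betw g {..<card I} I"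
    using ex_bij_betw_nat_finite[OF I] by (auto simp: atLeast0LessThan)
  define N where "N = mat m m (\<lambda>(i, j). if i < card I then a (g i) (f j) else 0)"
  have N: "N \<in> carrier_mat m m" by (simp add: N_def)
  have "det N = 0"
  proof -
    \<comment> \<open>This is the first padding row; it exists because
      \<open>card I < m\<close>.\<close>
    have "row N (card I) = 0\<^sub>v m"
      using less by (intro eq_vecI) (auto simp: N_def m_def)
    then have "N = mat\<^sub>r m m (\<lambda>i. if i = card I then 0\<^sub>v m else row N i)"
      using N by (intro eq_matI) (auto simp: mat_of_rows_def row_def N_def)
    then show ?thesis
      using det_row_0[of "card I" m "row N"] less N by (auto simp: m_def)
  qed
  then obtain y where y: "y \<in> carrier_vec m" "y \<noteq> 0\<^sub>v m" and Ny: "N *\<^sub>v y = 0\<^sub>v m"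
    using det_0_iff_vec_prod_zero[OF N] by blast
  define x where "x u = y $ inv_into {..<m} f u" for u
  have xf: "x (f j) = y $ j" if "j < m" for j
    using that f by (simp add: x_def bij_betw_def)
  show ?thesis
  proof (rule that)
    obtain j where "j < m" "y $ j \<noteq> 0"
      using y by (metis carrier_vecD eq_vecI index_zero_vec)
    then show "\<exists>u\<in>U. x u \<noteq> 0"
      using f xf by (metis bij_betw_apply lessThan_iff)
  next
    fix i assume "i \<in> I"
    then obtain l where l: "l < card I" "g l = i"
      using g by (metis bij_betw_iff_bijections lessThan_iff)
    have "(\<Sum>u\<in>U. a i u * x u) = (\<Sum>j<m. a i (f j) * y $ j)"
      using xf by (subst sum.reindex_bij_betw[OF f, symmetric]) simp
    also have "\<dots> = (N *\<^sub>v y) $ l"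
      using l less y by (simp add: N_def m_def scalar_prod_def atLeast0LessThan)
    finally show "(\<Sum>u\<in>U. a i u * x u) = 0"
      using Ny l less by (simp add: m_def)
  qed
qed

text \<open>In the application \<open>b\<close> holds the entries of the orthogonal matrix
  \<open>P\<close> and \<open>c\<close> the values of \<open>p\<close> at the eigenvalues. Keeping
  \<open>c\<close> arbitrary lets the same lemma serve for \<open>-p\<close>.\<close>

lemma inertia_bound_ge:
  fixes b :: "nat \<Rightarrow> nat \<Rightarrow> real" and c :: "nat \<Rightarrow> real"
  assumes U: "U \<subseteq> {..<n}"
    and orth: "\<And>r s. r < n \<Longrightarrow> s < n \<Longrightarrow> (\<Sum>j<n. b r j * b s j) = (if r = s then 1 else 0)"
    and off: "\<And>r s. r \<in> U \<Longrightarrow> s \<in> U \<Longrightarrow> r \<noteq> s \<Longrightarrow> (\<Sum>j<n. b r j * c j * b s j) = 0"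
    and on: "\<And>r. r \<in> U \<Longrightarrow> w \<le> (\<Sum>j<n. b r j * c j * b r j)"
  shows "card U \<le> card {j. j < n \<and> w \<le> c j}"
proof (rule ccontr)
  let ?J = "{j. j < n \<and> w \<le> c j}"
  assume "\<not> ?thesis"
  then have less: "card ?J < card U" by simp
  have finU: "finite U" using U finite_subset by blast
  obtain x where x: "\<exists>u\<in>U. x u \<noteq> 0" and xJ: "\<And>j. j \<in> ?J \<Longrightarrow> (\<Sum>u\<in>U. b u j * x u) = 0"
    using homogeneous_system_nontrivial_solution[OF _ finU less, of "\<lambda>j u. b u j"] by auto
  \<comment> \<open>These are the coordinates of \<open>x\<close> in the eigenbasis; by the choice
    of \<open>x\<close> they vanish on \<open>?J\<close>.\<close>
  define y where "y j = (\<Sum>u\<in>U. b u j * x u)" for j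
  \<comment> \<open>Used with \<open>d = 1\<close> for the squared norm and with
    \<open>d = c\<close> for the quadratic form; in both cases \<open>diag\<close> then removes the
    off-diagonal terms.\<close>
  have expand: "(\<Sum>j<n. d j * (y j)\<^sup>2) = (\<Sum>r\<in>U. \<Sum>s\<in>U. (\<Sum>j<n. b r j * d j * b s j) * (x r * x s))"
    for d :: "nat \<Rightarrow> real"
  proof -
    have "(\<Sum>j<n. d j * (y j)\<^sup>2) = (\<Sum>j<n. \<Sum>r\<in>U. \<Sum>s\<in>U. b r j * d j * b s j * (x r * x s))"
      by (simp add: y_def power2_eq_square sum_product sum_distrib_left mult_ac)
    also have "\<dots> = (\<Sum>r\<in>U. \<Sum>s\<in>U. \<Sum>j<n. b r j * d j * b s j * (x r * x s))"
      by (subst sum.swap, rule sum.cong[OF refl], subst sum.swap, rule refl)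
    finally show ?thesis by (simp add: sum_distrib_right)
  qed
  have diag: "(\<Sum>s\<in>U. m r s * (x r * x s)) = m r r * (x r)\<^sup>2"
    if "r \<in> U" "\<And>s. s \<in> U \<Longrightarrow> s \<noteq> r \<Longrightarrow> m r s = 0" for r and m :: "nat \<Rightarrow> nat \<Rightarrow> real"
  proof -
    have "(\<Sum>s\<in>U. m r s * (x r * x s)) = (\<Sum>s\<in>U. if r = s then m r r * (x r)\<^sup>2 else 0)"
      using that by (intro sum.cong) (auto simp: power2_eq_square)
    then show ?thesis using that finU by simp
  qed
  have norm: "(\<Sum>j<n. (y j)\<^sup>2) = (\<Sum>r\<in>U. (x r)\<^sup>2)"
  proof -
    have "(\<Sum>j<n. (y j)\<^sup>2) = (\<Sum>r\<in>U. \<Sum>s\<in>U. (if r = s then 1 else 0) * (x r * x s))"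
      using expand[of "\<lambda>_. 1"] U orth by (simp add: subset_iff)
    also have "\<dots> = (\<Sum>r\<in>U. (x r)\<^sup>2)"
      by (intro sum.cong refl, subst diag) auto
    finally show ?thesis .
  qed
  have "w * (\<Sum>j<n. (y j)\<^sup>2) = (\<Sum>r\<in>U. w * (x r)\<^sup>2)"
    by (simp add: norm sum_distrib_left)
  also have "\<dots> \<le> (\<Sum>r\<in>U. (\<Sum>j<n. b r j * c j * b r j) * (x r)\<^sup>2)"
    using on by (intro sum_mono mult_right_mono) auto
  also have "\<dots> = (\<Sum>j<n. c j * (y j)\<^sup>2)"
    using off by (simp add: expand diag[where m = "\<lambda>r s. \<Sum>j<n. b r j * c j * b s j"])
  \<comment> \<open>Any \<open>j\<close> with \<open>y j \<noteq> 0\<close> lies outside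
    \<open>?J\<close>, so \<open>c j < w\<close> there. Such a \<open>j\<close> exists because
    \<open>y\<close> has the same norm as the nonzero \<open>x\<close>.\<close>
  also have "\<dots> < (\<Sum>j<n. w * (y j)\<^sup>2)"
  proof (rule sum_strict_mono_ex1)
    have small: "c j < w" if "j < n" "y j \<noteq> 0" for j
      using that xJ[of j] by (force simp: y_def)
    show "\<forall>j\<in>{..<n}. c j * (y j)\<^sup>2 \<le> w * (y j)\<^sup>2"
    proof
      fix j assume "j \<in> {..<n}"
      then show "c j * (y j)\<^sup>2 \<le> w * (y j)\<^sup>2"
        using small[of j] by (cases "y j = 0") (auto intro: mult_right_mono)
    qed
    have "(\<Sum>r\<in>U. (x r)\<^sup>2) > 0"
      using x finU by (auto intro!: sum_pos2)
    then have "\<not> (\<forall>j\<in>{..<n}. (y j)\<^sup>2 = 0)"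
      unfolding norm[symmetric] using sum.neutral[of "{..<n}" "\<lambda>j. (y j)\<^sup>2"] by linarith
    then obtain j where "j < n" "y j \<noteq> 0" by auto
    then show "\<exists>j\<in>{..<n}. c j * (y j)\<^sup>2 < w * (y j)\<^sup>2"
      using small by (intro bexI[of _ j] mult_strict_right_mono) auto
  qed simp
  finally show False by (simp add: sum_distrib_left)
qed

section \<open>Walks, distances and powers of the adjacency matrix\<close>

text \<open>A nonzero entry of a product needs a nonzero summand, which extends a walk of length
  \<open>i\<close> by one arc. Only existence of a walk matters later, so walks are not
  counted.\<close>

lemma adjacency_matrix_pow_nonzero_awalk:
  assumes "wf_digraph G" and vs: "set vs = verts G"
    and "r < length vs" "s < length vs"
    and "(adjacency_matrix G vs ^\<^sub>m i) $$ (r, s) \<noteq> 0"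
  shows "\<exists>q. pre_digraph.awalk G (vs ! r) q (vs ! s) \<and> length q = i"
  using assms(4,5)
proof (induction i arbitrary: s)
  interpret wf_digraph G by fact
  let ?A = "adjacency_matrix G vs"
  have A: "?A \<in> carrier_mat (length vs) (length vs)" by (simp add: adjacency_matrix_def)
  {
    case 0
    then have "r = s" using A assms(3) by (auto split: if_splits)
    moreover have "vs ! r \<in> verts G"
      using nth_mem[OF assms(3)] unfolding vs .
    ultimately show ?case
      by (intro exI[of _ "[]"]) (simp add: awalk_Nil_iff)
  next
    case (Suc i)
    have "(?A ^\<^sub>m Suc i) $$ (r, s) = (\<Sum>t\<in>{0..<length vs}. (?A ^\<^sub>m i) $$ (r, t) * ?A $$ (t, s))"
      using A Suc.prems assms(3) by (simp add: scalar_prod_def)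
    then obtain t where t: "t < length vs" "(?A ^\<^sub>m i) $$ (r, t) \<noteq> 0" "?A $$ (t, s) \<noteq> 0"
      using Suc.prems by (metis (no_types, lifting) atLeastLessThan_iff mult_eq_0_iff sum.neutral)
    then obtain q where q: "awalk (vs ! r) q (vs ! t)" "length q = i"
      using Suc.IH by blast
    have "(vs ! t, vs ! s) \<in> arcs_ends G"
      using t Suc.prems by (simp add: adjacency_matrix_def split: if_splits)
    then obtain e where "e \<in> arcs G" "tail G e = vs ! t" "head G e = vs ! s"
      by (auto simp: arcs_ends_def arc_to_ends_def)
    then have "awalk (vs ! t) [e] (vs ! s)"
      by (auto simp: awalk_Cons_iff awalk_Nil_iff dest: head_in_verts)
    then have "awalk (vs ! r) (q @ [e]) (vs ! s)"
      using q by (intro awalk_appendI)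
    then show ?case using q by (intro exI[of _ "q @ [e]"]) simp
  }
qed

lemma (in wf_digraph) awalk_cost_one: "awalk_cost (\<lambda>_. 1) q = real (length q)"
  by (induction q) auto

text \<open>A nonzero entry of a power \<open>i \<le> degree p\<close> would give a walk of length
  \<open>i\<close>, hence distance at most \<open>k\<close>. So every term of the matrix polynomial
  vanishes at this position.\<close>

lemma poly_mat_adjacency_far:
  assumes "wf_digraph G" and "set vs = verts G"
    and r: "r < length vs" and s: "s < length vs"
    and deg: "degree p \<le> k" and far: "graph_dist G (vs ! r) (vs ! s) > ereal (real k)"
  shows "poly_mat p (adjacency_matrix G vs) $$ (r, s) = 0"
proof -
  interpret wf_digraph G by fact
  have "(adjacency_matrix G vs ^\<^sub>m i) $$ (r, s) = 0" if "i \<le> degree p" for i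
  proof (rule ccontr)
    assume "\<not> ?thesis"
    then obtain q where "awalk (vs ! r) q (vs ! s)" "length q = i"
      using adjacency_matrix_pow_nonzero_awalk[OF assms(1,2) r s] by blast
    then have "graph_dist G (vs ! r) (vs ! s) \<le> ereal (real i)"
      using min_cost_le_walk_cost[of "vs ! r" q "vs ! s" "\<lambda>_. 1"]
      by (simp add: graph_dist_def awalk_cost_one)
    also have "\<dots> \<le> ereal (real k)" using that deg by simp
    finally show False using far by simp
  qed
  then show ?thesis
    using r s by (simp add: poly_mat_def adjacency_matrix_def)
qed

theorem theorem3p1:
  fixes G :: "('v, 'e) pre_digraph" and vs :: "'v list"
    and n k :: nat and p :: "real poly"
    and A :: "real mat" and W w :: real
  assumes "graph G"
    and "distinct vs" and "set vs = verts G"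
    and "n = card (verts G)"
    and "A = adjacency_matrix G vs"
    and "k \<ge> 1"
    and "degree p \<le> k"
    and "W = Max ((\<lambda>u. poly_mat p A $$ (u, u)) ` {..<n})"
    and "w = Min ((\<lambda>u. poly_mat p A $$ (u, u)) ` {..<n})"
  shows "k_independence_number G k \<le>
    min (card {i. i < n \<and> poly p (eigenvalues A ! i) \<ge> w})
        (card {i. i < n \<and> poly p (eigenvalues A ! i) \<le> W})"
proof -
  interpret graph G by fact
  have n: "n = length vs" using assms distinct_card by metis
  have A: "A \<in> carrier_mat n n" using assms n by (simp add: adjacency_matrix_def)
  have "transpose_mat A = A"
    using sym_arcs assms(5)
    by (intro eq_matI) (auto simp: adjacency_matrix_def symmetric_def dest: symD)
  then obtain D P where sim: "similar_mat_wit A D P (transpose_mat P)" and diag: "diagonal_mat D"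
    using symmetric_mat_diagonalizable[OF A] by blast
  define b c where "b r j = P $$ (r, j)" and "c j = poly p (D $$ (j, j))" for r j
  have P: "P \<in> carrier_mat n n" and PP: "P * transpose_mat P = 1\<^sub>m n"
    using similar_mat_witD2[OF A sim] by auto
  have orth: "(\<Sum>j<n. b r j * b s j) = (if r = s then 1 else 0)" if "r < n" "s < n" for r s
    using arg_cong[OF PP, of "\<lambda>M. M $$ (r, s)"] P that
    by (simp add: b_def scalar_prod_def atLeast0LessThan)
  have entry: "(\<Sum>j<n. b r j * c j * b s j) = poly_mat p A $$ (r, s)" if "r < n" "s < n" for r s
    using poly_mat_orthogonal_diagonalization[OF A sim diag that] by (simp add: b_def c_def)
  \<comment> \<open>Both eigenvalue counts of the claim become counts over the diagonal of
    \<open>D\<close>, the form in which the inertia bound is stated.\<close>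
  have count: "card {i. i < n \<and> Q (poly p (eigenvalues A ! i))} = card {j. j < n \<and> Q (c j)}" for Q
    unfolding c_def
    using card_nth_filter_eq[OF mset_eigenvalues_similar_diagonal[OF A sim diag],
        of "\<lambda>x. Q (poly p x)"] .
  have bound: "card S \<le> card {j. j < n \<and> w \<le> c j}" "card S \<le> card {j. j < n \<and> c j \<le> W}"
    if S: "k_independent G k S" for S
  proof -
    \<comment> \<open>\<open>U\<close> is the set of matrix indices of the vertices in
      \<open>S\<close>.\<close>
    define U where "U = {i. i < n \<and> vs ! i \<in> S}"
    have U: "U \<subseteq> {..<n}" by (auto simp: U_def)
    have "bij_betw ((!) vs) U S"
      unfolding bij_betw_def
    proof
      show "inj_on ((!) vs) U"
        using assms(2) n by (intro inj_on_nth) (auto simp: U_def)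
      show "(!) vs ` U = S"
      proof (intro subset_antisym)
        show "S \<subseteq> (!) vs ` U"
        proof
          fix v assume "v \<in> S"
          then have "v \<in> set vs" using S assms(3) by (auto simp: k_independent_def)
          then show "v \<in> (!) vs ` U"
            using \<open>v \<in> S\<close> n unfolding in_set_conv_nth U_def by blast
        qed
      qed (auto simp: U_def)
    qed
    then have cardU: "card U = card S" by (rule bij_betw_same_card)
    have off: "(\<Sum>j<n. b r j * c j * b s j) = 0" if "r \<in> U" "s \<in> U" "r \<noteq> s" for r s
    proof -
      have "vs ! r \<noteq> vs ! s"
        using that assms(2) n by (simp add: U_def nth_eq_iff_index_eq)
      then have "poly_mat p A $$ (r, s) = 0"
        unfolding assms(5) using that S n
        by (intro poly_mat_adjacency_far[OF wf_digraph_axioms assms(3) _ _ assms(7)])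
           (auto simp: U_def k_independent_def)
      then show ?thesis using that U entry by (auto simp: subset_iff)
    qed
    have on: "w \<le> (\<Sum>j<n. b r j * c j * b r j)" "(\<Sum>j<n. b r j * c j * b r j) \<le> W"
      if "r \<in> U" for r
      using that U entry assms(8,9) by (auto simp: subset_iff)
    show "card S \<le> card {j. j < n \<and> w \<le> c j}"
      using inertia_bound_ge[OF U orth off on(1)] cardU by simp
    \<comment> \<open>Negating \<open>c\<close> and \<open>W\<close> turns the upper bound on the
      diagonal entries into the lower bound that the inertia lemma expects.\<close>
    have "card U \<le> card {j. j < n \<and> - W \<le> - c j}"
      using inertia_bound_ge[OF U orth, of "\<lambda>j. - c j" "- W"] off on(2)
      by (simp add: sum_negf)
    then show "card S \<le> card {j. j < n \<and> c j \<le> W}"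
      using cardU by simp
  qed
  \<comment> \<open>The family is finite and contains the empty set, so its maximal cardinality is
    attained by some \<open>S\<close> to which \<open>bound\<close> applies.\<close>
  have "finite {S. k_independent G k S}"
    by (rule finite_subset[of _ "Pow (verts G)"]) (auto simp: k_independent_def)
  moreover have "k_independent G k {}" by (simp add: k_independent_def)
  ultimately have "k_independence_number G k \<in> card ` {S. k_independent G k S}"
    unfolding k_independence_number_def by (intro Max_in) auto
  then show ?thesis
    using bound count[of "\<lambda>x. w \<le> x"] count[of "\<lambda>x. x \<le> W"] by auto
qed

end
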